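(* Let $N \geq 0$ be an integer and let $L(y) = \sum_{k=0}^{N} a_k(x)\, y^{(k)}$, where each $a_k$ is a real polynomial of degree $\leq k$. Then for every integer $n \geq 0$, $L$ maps the space $P_n$ of all polynomials of degree at most $n$ into itself. All eigenvalues of $L$ on $P_n$ are real, and they are given by the numbers $\lambda_j$, $0 \leq j \leq n$, where $\lambda_j$ is the coefficient of $x^j$ in $L(x^j)$. Moreover, if the eigenvalues $\lambda_j$, $j = 0, 1, 2, \dots$, are pairwise distinct, then for every integer $n \geq 0$ there is, up to a nonzero constant factor, a unique polynomial of degree exactly $n$ which is an eigenfunction of $L$.
   Context: $P_n$ denotes the vector space of polynomials in $x$ with real coefficients of degree at most $n$, and $y^{(k)}$ is the $k$-th derivative of $y$ (with $y^{(0)} = y$). An eigenfunction of $L$ is a nonzero $y$ with $L(y) = \lambda y$ for some scalar $\lambda$, called the eigenvalue. That all eigenvalues of $L$ on $P_n$ are real means that all roots of the characteristic polynomial of the linear map $L : P_n \to P_n$ are real. *)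

theory Defs
  imports "HOL-Computational_Algebra.Polynomial" "Jordan_Normal_Form.Char_Poly"
begin

hide_const (open) Module.smult

definition polys_upto :: "nat \<Rightarrow> real poly set" where
  "polys_upto n = {p. degree p \<le> n}"

definition diff_op :: "nat \<Rightarrow> (nat \<Rightarrow> real poly) \<Rightarrow> real poly \<Rightarrow> real poly" where
  "diff_op N a y = (\<Sum>k\<le>N. a k * (pderiv ^^ k) y)"

definition eigenfunction :: "(real poly \<Rightarrow> real poly) \<Rightarrow> real \<Rightarrow> real poly \<Rightarrow> bool" where
  "eigenfunction T c y \<longleftrightarrow> y \<noteq> 0 \<and> T y = smult c y"

global_interpretation poly_vs: Vector_Spaces.vector_space "smult :: real \<Rightarrow> real poly \<Rightarrow> real poly"
  by unfold_locales (auto simp: smult_add_right smult_add_left)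

global_interpretation poly_vs_pair: Vector_Spaces.vector_space_pair
  "smult :: real \<Rightarrow> real poly \<Rightarrow> real poly" "smult :: real \<Rightarrow> real poly \<Rightarrow> real poly"
  by unfold_locales

definition ordered_basis :: "real poly set \<Rightarrow> real poly list \<Rightarrow> bool" where
  "ordered_basis V bs \<longleftrightarrow> distinct bs \<and> poly_vs.independent (set bs) \<and> poly_vs.span (set bs) = V"

text \<open>The matrix of \<open>T\<close> with respect to a basis \<open>bs\<close> of the source and a basis \<open>cs\<close> of the target:
  column \<open>j\<close> holds the \<open>cs\<close>-coordinates of \<open>T (bs ! j)\<close>.\<close>

definition lin_matrix :: "real poly list \<Rightarrow> real poly list \<Rightarrow> (real poly \<Rightarrow> real poly) \<Rightarrow> real mat" where
  "lin_matrix cs bs T = mat (length cs) (length bs)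
     (\<lambda>(i, j). poly_vs.representation (set cs) (T (bs ! j)) (cs ! i))"

text \<open>The characteristic polynomial of an endomorphism \<open>T\<close> of a finite-dimensional space \<open>V\<close>.
  It does not depend on the chosen basis, see \<open>char_poly_on_eq\<close> below.\<close>

definition char_poly_on :: "real poly set \<Rightarrow> (real poly \<Rightarrow> real poly) \<Rightarrow> real poly" where
  "char_poly_on V T = (let bs = (SOME bs. ordered_basis V bs) in char_poly (lin_matrix bs bs T))"

text \<open>All complex eigenvalues, counted with algebraic multiplicity.\<close>

definition eigenvalues_on :: "real poly set \<Rightarrow> (real poly \<Rightarrow> real poly) \<Rightarrow> complex multiset" where
  "eigenvalues_on V T = proots (map_poly complex_of_real (char_poly_on V T))"

lemma lin_matrix_mult:
  assumes bs: "ordered_basis V bs" and cs: "ordered_basis V cs" and ds: "ordered_basis V ds"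
    and U: "Vector_Spaces.linear smult smult U" "U ` V \<subseteq> V" and W: "W ` V \<subseteq> V"
  shows "lin_matrix cs bs U * lin_matrix bs ds W = lin_matrix cs ds (U \<circ> W)"
proof (rule eq_matI)
  fix i j assume "i < dim_row (lin_matrix cs ds (U \<circ> W))" "j < dim_col (lin_matrix cs ds (U \<circ> W))"
  hence ij: "i < length cs" "j < length ds" by (auto simp: lin_matrix_def)
  let ?w = "W (ds ! j)" and ?rb = "poly_vs.representation (set bs)"
    and ?rc = "poly_vs.representation (set cs)"
  have mem: "bs ! k \<in> V" if "k < length bs" for k
    using bs that by (auto simp: ordered_basis_def intro: poly_vs.span_base)
  have "ds ! j \<in> V"
    using ds ij by (auto simp: ordered_basis_def intro: poly_vs.span_base)
  hence w: "?w \<in> V" using W by auto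
  have "?w = (\<Sum>b\<in>set bs. smult (?rb ?w b) b)"
    using bs w by (intro poly_vs.sum_representation_eq[symmetric]) (auto simp: ordered_basis_def)
  also have "\<dots> = (\<Sum>k<length bs. smult (?rb ?w (bs ! k)) (bs ! k))"
    using bs by (intro sum.reindex_bij_betw[symmetric])
      (auto simp: ordered_basis_def intro: bij_betw_nth)
  finally have *: "U ?w = U \<dots>" by (rule arg_cong)
  have "U ?w = (\<Sum>k<length bs. smult (?rb ?w (bs ! k)) (U (bs ! k)))"
    unfolding * poly_vs_pair.linear_sum[OF U(1)] poly_vs_pair.linear_scale[OF U(1)] ..
  also have "?rc \<dots> = (\<lambda>b. \<Sum>k<length bs. ?rc (smult (?rb ?w (bs ! k)) (U (bs ! k))) b)"
    using cs U(2) mem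
    by (intro poly_vs.representation_sum) (auto simp: ordered_basis_def intro!: poly_vs.span_scale)
  also have "\<dots> = (\<lambda>b. \<Sum>k<length bs. ?rb ?w (bs ! k) * ?rc (U (bs ! k)) b)"
  proof (intro ext sum.cong refl)
    fix b k assume "k \<in> {..<length bs}"
    hence "U (bs ! k) \<in> V" using mem U(2) by auto
    hence "U (bs ! k) \<in> poly_vs.span (set cs)" using cs by (simp add: ordered_basis_def)
    thus "?rc (smult (?rb ?w (bs ! k)) (U (bs ! k))) b = ?rb ?w (bs ! k) * ?rc (U (bs ! k)) b"
      using cs by (subst poly_vs.representation_scale) (auto simp: ordered_basis_def)
  qed
  finally have "?rc (U ?w) (cs ! i) = (\<Sum>k<length bs. ?rb ?w (bs ! k) * ?rc (U (bs ! k)) (cs ! i))"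
    by (rule fun_cong)
  thus "(lin_matrix cs bs U * lin_matrix bs ds W) $$ (i, j) = lin_matrix cs ds (U \<circ> W) $$ (i, j)"
    using ij by (simp add: lin_matrix_def scalar_prod_def atLeast0LessThan mult.commute)
qed (auto simp: lin_matrix_def)

lemma lin_matrix_id:
  assumes "ordered_basis V bs"
  shows "lin_matrix bs bs id = 1\<^sub>m (length bs)"
  using assms
  by (intro eq_matI) (auto simp: lin_matrix_def ordered_basis_def poly_vs.representation_basis
      nth_eq_iff_index_eq)

lemma ordered_basis_length:
  assumes "ordered_basis V bs" "ordered_basis V cs"
  shows "length bs = length cs"
  using assms poly_vs.dim_span_eq_card_independent[of "set bs"]
    poly_vs.dim_span_eq_card_independent[of "set cs"]
  by (auto simp: ordered_basis_def distinct_card)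

lemma char_poly_on_eq:
  assumes bs: "ordered_basis V bs"
    and T: "Vector_Spaces.linear smult smult T" "T ` V \<subseteq> V"
  shows "char_poly_on V T = char_poly (lin_matrix bs bs T)"
proof -
  define cs where "cs = (SOME bs. ordered_basis V bs)"
  have cs: "ordered_basis V cs" unfolding cs_def using bs by (rule someI)
  have id: "Vector_Spaces.linear smult smult (id :: real poly \<Rightarrow> _)"
    by (rule poly_vs.linear_id)
  have len: "length cs = length bs" using ordered_basis_length[OF cs bs] .
  have "similar_mat (lin_matrix cs cs T) (lin_matrix bs bs T)"
  proof (rule similar_matI)
    show "{lin_matrix cs cs T, lin_matrix bs bs T, lin_matrix cs bs id, lin_matrix bs cs id}
            \<subseteq> carrier_mat (length bs) (length bs)"
      by (auto simp: lin_matrix_def len)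
    show "lin_matrix cs bs id * lin_matrix bs cs id = 1\<^sub>m (length bs)"
      using lin_matrix_mult[OF bs cs cs id, of id] lin_matrix_id[OF cs] len by simp
    show "lin_matrix bs cs id * lin_matrix cs bs id = 1\<^sub>m (length bs)"
      using lin_matrix_mult[OF cs bs bs id, of id] lin_matrix_id[OF bs] by simp
    show "lin_matrix cs cs T = lin_matrix cs bs id * lin_matrix bs bs T * lin_matrix bs cs id"
      using lin_matrix_mult[OF bs cs bs id _ T(2)] lin_matrix_mult[OF bs cs cs T, of id] by simp
  qed
  from char_poly_similar[OF this] show ?thesis
    by (simp add: char_poly_on_def cs_def[symmetric])
qed

end

theory Submission
  imports Defs
begin

text \<open>
  The operator \<open>L\<close> never raises degrees: the \<open>k\<close>-th derivative lowers the degree by \<open>k\<close>, and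
  multiplication by \<open>a k\<close> raises it by at most \<open>k\<close>. Everything except this observation holds for
  an arbitrary linear operator \<open>T\<close> on polynomials that does not raise degrees, and is proved for
  those.

  In the basis \<open>1, x, ..., x\<^sup>n\<close> such an operator has an upper triangular matrix on \<open>P\<^sub>n\<close> whose
  diagonal entries are the numbers \<open>\<lambda>\<^sub>j\<close>, so its characteristic polynomial is the product of the
  \<open>x - \<lambda>\<^sub>j\<close>. This gives the eigenvalues with multiplicities, all of them real
  (\<open>eigenvalues_on_polys_upto\<close>).

  For the eigenfunctions, triangularity takes the form \<open>coeff_image_top\<close>: on polynomials of degree
  at most \<open>n\<close>, the coefficient of \<open>x\<^sup>n\<close> is multiplied by \<open>\<lambda>\<^sub>n\<close>. Hence an eigenfunction of degree
  \<open>n\<close> has eigenvalue \<open>\<lambda>\<^sub>n\<close>. Conversely, if \<open>\<lambda>\<^sub>n\<close> differs from all earlier \<open>\<lambda>\<^sub>i\<close>, then \<open>T - \<lambda>\<^sub>n\<close> can be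
  inverted on polynomials of degree below \<open>n\<close> by eliminating leading terms
  (\<open>shifted_surj_below\<close>), and \<open>x\<^sup>n\<close> can be corrected by lower terms to an eigenfunction. Every
  eigenvalue arises in this way from the first index at which it occurs. When all \<open>\<lambda>\<^sub>j\<close> are distinct,
  two eigenfunctions of degree \<open>n\<close> share the eigenvalue \<open>\<lambda>\<^sub>n\<close>; the combination that cancels their
  leading terms would, if nonzero, be an eigenfunction for \<open>\<lambda>\<^sub>n\<close> of some degree \<open>m < n\<close>, which
  forces \<open>\<lambda>\<^sub>m = \<lambda>\<^sub>n\<close> (\<open>eigenfunction_unique\<close>).
\<close>

section \<open>The monomial basis\<close>

lemma span_monom_atMost:
  "poly_vs.span ((\<lambda>i. monom 1 i) ` {..n}) = polys_upto n"
proof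
  have "poly_vs.subspace (polys_upto n)"
    by (auto simp: poly_vs.subspace_def polys_upto_def intro: degree_add_le)
  moreover have "(\<lambda>i. monom 1 i) ` {..n} \<subseteq> polys_upto n"
    by (auto simp: polys_upto_def degree_monom_eq)
  ultimately show "poly_vs.span ((\<lambda>i. monom 1 i) ` {..n}) \<subseteq> polys_upto n"
    by (rule poly_vs.span_minimal[rotated])
next
  show "polys_upto n \<subseteq> poly_vs.span ((\<lambda>i. monom 1 i) ` {..n})"
  proof
    fix p assume "p \<in> polys_upto n"
    hence "p = (\<Sum>i\<le>n. smult (coeff p i) (monom 1 i))"
      by (simp add: polys_upto_def smult_monom poly_as_sum_of_monoms')
    also have "\<dots> \<in> poly_vs.span ((\<lambda>i. monom 1 i) ` {..n})"
      by (intro poly_vs.span_sum poly_vs.span_scale poly_vs.span_base) auto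
    finally show "p \<in> poly_vs.span ((\<lambda>i. monom 1 i) ` {..n})" .
  qed
qed

lemma inj_monom_one: "inj_on (\<lambda>i. monom (1 :: real) i) A"
  by (auto simp: inj_on_def monom_eq_iff')

lemma coeff_combination_monoms:
  fixes u :: "real poly \<Rightarrow> real"
  assumes "i \<le> n"
  shows "coeff (\<Sum>b\<in>(\<lambda>i. monom 1 i) ` {..n}. smult (u b) b) i = u (monom 1 i)"
  using assms by (simp add: sum.reindex[OF inj_monom_one] coeff_sum if_distrib cong: if_cong)

lemma independent_monoms: "poly_vs.independent ((\<lambda>i. monom 1 i) ` {..n})"
proof -
  have "u (monom 1 i) = 0"
    if "(\<Sum>b\<in>(\<lambda>i. monom 1 i) ` {..n}. smult (u b) b) = 0" "i \<le> n" for u :: "real poly \<Rightarrow> real" and i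
    using coeff_combination_monoms[OF that(2), of u] that(1) by simp
  thus ?thesis by (auto simp: poly_vs.dependent_finite)
qed

lemma ordered_basis_monoms: "ordered_basis (polys_upto n) (map (\<lambda>i. monom 1 i) [0..<Suc n])"
proof -
  have "set (map (\<lambda>i. monom (1 :: real) i) [0..<Suc n]) = (\<lambda>i. monom 1 i) ` {..n}"
    by (simp only: set_map set_upt atLeast0LessThan lessThan_Suc_atMost)
  thus ?thesis
    unfolding ordered_basis_def
    by (simp only: distinct_map distinct_upt inj_monom_one independent_monoms span_monom_atMost
        simp_thms)
qed

lemma representation_monoms:
  assumes "degree p \<le> n" "i \<le> n"
  shows "poly_vs.representation ((\<lambda>i. monom 1 i) ` {..n}) p (monom 1 i) = coeff p i"
proof -
  let ?B = "(\<lambda>i. monom (1 :: real) i) ` {..n}"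
  have "(\<Sum>b\<in>?B. smult (poly_vs.representation ?B p b) b) = p"
    using assms(1)
    by (intro poly_vs.sum_representation_eq)
      (simp_all add: independent_monoms span_monom_atMost polys_upto_def)
  thus ?thesis using coeff_combination_monoms[OF assms(2)] by metis
qed

section \<open>Linear operators that do not raise degrees\<close>

locale degree_nonincreasing =
  fixes T :: "real poly \<Rightarrow> real poly"
  assumes lin: "Vector_Spaces.linear smult smult T"
    and degree_image_le: "degree (T p) \<le> degree p"
begin

definition diag :: "nat \<Rightarrow> real" where
  "diag j = coeff (T (monom 1 j)) j"

lemmas T_add = poly_vs_pair.linear_add[OF lin]
lemmas T_diff = poly_vs_pair.linear_diff[OF lin]
lemmas T_scale = poly_vs_pair.linear_scale[OF lin]
lemmas T_sum = poly_vs_pair.linear_sum[OF lin]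

lemma image_polys_upto: "T ` polys_upto n \<subseteq> polys_upto n"
  by (auto simp: polys_upto_def intro: order.trans[OF degree_image_le])

text \<open>The lower monomials of \<open>p\<close> are mapped to polynomials of degree below \<open>n\<close>, so only the
  \<open>x\<^sup>n\<close>-term of \<open>p\<close> contributes.\<close>

lemma coeff_image_top:
  assumes "degree p \<le> n"
  shows "coeff (T p) n = diag n * coeff p n"
proof -
  have low: "coeff (T (monom 1 i)) n = 0" if "i < n" for i
    using degree_image_le[of "monom 1 i"] that by (intro coeff_eq_0) (simp add: degree_monom_eq)
  have "T p = T (\<Sum>i\<le>n. smult (coeff p i) (monom 1 i))"
    using assms by (simp add: smult_monom poly_as_sum_of_monoms')
  also have "\<dots> = (\<Sum>i\<le>n. smult (coeff p i) (T (monom 1 i)))"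
    by (simp only: T_sum T_scale)
  finally have "coeff (T p) n = (\<Sum>i\<le>n. coeff p i * coeff (T (monom 1 i)) n)"
    by (simp add: coeff_sum)
  also have "\<dots> = (\<Sum>i\<in>{n}. coeff p i * coeff (T (monom 1 i)) n)"
    by (intro sum.mono_neutral_right) (auto simp: low)
  finally show ?thesis by (simp add: diag_def mult.commute)
qed

section \<open>The characteristic polynomial\<close>

lemma lin_matrix_monoms:
  "lin_matrix (map (\<lambda>i. monom 1 i) [0..<Suc n]) (map (\<lambda>i. monom 1 i) [0..<Suc n]) T
     = mat (Suc n) (Suc n) (\<lambda>(i, j). coeff (T (monom 1 j)) i)"
proof -
  have set: "set (map (\<lambda>i. monom (1 :: real) i) [0..<Suc n]) = (\<lambda>i. monom 1 i) ` {..n}"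
    by (simp only: set_map set_upt atLeast0LessThan lessThan_Suc_atMost)
  have "poly_vs.representation ((\<lambda>i. monom 1 i) ` {..n}) (T (monom 1 j)) (monom 1 i)
          = coeff (T (monom 1 j)) i" if "i \<le> n" "j \<le> n" for i j
    using degree_image_le[of "monom 1 j"] that
    by (intro representation_monoms) (simp_all add: degree_monom_eq)
  thus ?thesis
    unfolding lin_matrix_def set by (intro eq_matI) (simp_all del: upt_Suc)
qed

lemma char_poly_on_polys_upto:
  "char_poly_on (polys_upto n) T = (\<Prod>j\<leftarrow>[0..<Suc n]. [:- diag j, 1:])"
proof -
  define A where "A = mat (Suc n) (Suc n) (\<lambda>(i, j). coeff (T (monom 1 j)) i)"
  have A: "A \<in> carrier_mat (Suc n) (Suc n)" by (simp add: A_def)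
  have "upper_triangular A"
  proof
    fix i j assume "j < i" "i < dim_row A"
    moreover have "coeff (T (monom 1 j)) i = 0" if "j < i"
      using degree_image_le[of "monom 1 j"] that by (intro coeff_eq_0) (simp add: degree_monom_eq)
    ultimately show "A $$ (i, j) = 0" by (simp add: A_def)
  qed
  moreover have "diag_mat A = map diag [0..<Suc n]"
    by (auto simp: diag_mat_def A_def diag_def simp del: upt_Suc)
  moreover have "char_poly_on (polys_upto n) T = char_poly A"
    unfolding A_def lin_matrix_monoms[symmetric]
    by (rule char_poly_on_eq[OF ordered_basis_monoms lin image_polys_upto])
  ultimately show ?thesis
    using char_poly_upper_triangular[OF A] by (simp add: comp_def del: upt_Suc)
qed

theorem eigenvalues_on_polys_upto:
  "eigenvalues_on (polys_upto n) T
     = image_mset (\<lambda>j. complex_of_real (diag j)) (mset_set {0..n})"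
proof -
  have roots: "proots (map_poly complex_of_real (\<Prod>j\<leftarrow>js. [:- diag j, 1:]))
      = mset (map (\<lambda>j. complex_of_real (diag j)) js)" for js
  proof (induction js)
    case (Cons j js)
    let ?p = "\<Prod>j\<leftarrow>js. [:- diag j, 1:]"
    have nz: "?p \<noteq> 0" by (auto simp: prod_list_zero_iff)
    interpret of_real_poly: map_poly_inj_idom_hom complex_of_real ..
    have "map_poly complex_of_real ([:- diag j, 1:] * ?p)
        = [:- complex_of_real (diag j), 1:] * map_poly complex_of_real ?p"
      by (simp only: of_real_poly.hom_mult) (simp add: map_poly_pCons)
    moreover have "map_poly complex_of_real ?p \<noteq> 0"
      using nz by (simp add: map_poly_eq_0_iff)
    ultimately show ?case using Cons.IH by (simp add: proots_mult del: mult_pCons_left)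
  qed simp
  have "mset [0..<Suc n] = mset_set {0..n}"
    by (simp only: mset_upt atLeastLessThanSuc_atLeastAtMost)
  thus ?thesis
    unfolding eigenvalues_on_def char_poly_on_polys_upto roots by (simp only: mset_map)
qed

section \<open>Eigenfunctions\<close>

lemma eigenvalue_eq_diag_degree:
  assumes "eigenfunction T c y"
  shows "c = diag (degree y)"
  using coeff_image_top[of y "degree y"] assms by (simp add: eigenfunction_def)

text \<open>Solving for the coefficients from the top down: as \<open>T - c\<close> multiplies the leading coefficient
  by \<open>diag i - c \<noteq> 0\<close>, a suitable multiple of \<open>x\<^sup>i\<close> removes the leading term of the right-hand
  side. The condition on coefficients says that the degree is below \<open>n\<close> and lets \<open>n = 0\<close> stand for
  the zero polynomial.\<close>

lemma shifted_surj_below: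
  assumes "\<And>i. i < n \<Longrightarrow> diag i \<noteq> c" and "\<And>i. i \<ge> n \<Longrightarrow> coeff r i = 0"
  shows "\<exists>q. (\<forall>i\<ge>n. coeff q i = 0) \<and> T q - smult c q = r"
  using assms
proof (induction n arbitrary: r)
  case 0
  hence "r = 0" by (simp add: poly_eq_iff)
  thus ?case using T_scale[of 0 0] by (intro exI[of _ 0]) simp
next
  case (Suc n)
  define b where "b = coeff r n / (diag n - c)"
  define s where "s = r - (T (monom b n) - smult c (monom b n))"
  have deg: "degree (monom b n) \<le> n" by (rule degree_monom_le)
  have "coeff s i = 0" if "i \<ge> n" for i
  proof (cases "i = n")
    case True
    have "diag n \<noteq> c" using Suc.prems(1) by simp
    hence "b * (diag n - c) = coeff r n" by (simp add: b_def)
    thus ?thesis using coeff_image_top[OF deg] True by (simp add: s_def algebra_simps)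
  next
    case False
    hence "i > n" using that by simp
    moreover from this have "coeff (T (monom b n)) i = 0"
      using degree_image_le[of "monom b n"] deg by (intro coeff_eq_0) simp
    ultimately show ?thesis using Suc.prems(2) by (simp add: s_def)
  qed
  then obtain q where q: "\<forall>i\<ge>n. coeff q i = 0" "T q - smult c q = s"
    using Suc.IH Suc.prems(1) by (metis less_SucI)
  have "T (q + monom b n) - smult c (q + monom b n) = r"
    using q(2) by (simp only: T_add smult_add_right s_def algebra_simps)
  thus ?case using q(1) by (intro exI[of _ "q + monom b n"]) simp
qed

text \<open>The image of \<open>x\<^sup>n\<close> under \<open>T - diag n\<close> has degree below \<open>n\<close>, hence it is also minus the
  image of some \<open>q\<close> of degree below \<open>n\<close>, and \<open>x\<^sup>n + q\<close> is the eigenfunction.\<close>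

lemma eigenfunction_exists:
  assumes new: "\<And>i. i < n \<Longrightarrow> diag i \<noteq> diag n"
  shows "\<exists>y. degree y = n \<and> eigenfunction T (diag n) y"
proof -
  define r where "r = smult (diag n) (monom 1 n) - T (monom 1 n)"
  have "coeff r i = 0" if "i \<ge> n" for i
  proof (cases "i = n")
    case False
    hence "i > n" using that by simp
    moreover from this have "coeff (T (monom 1 n)) i = 0"
      using degree_image_le[of "monom 1 n"] by (intro coeff_eq_0) (simp add: degree_monom_eq)
    ultimately show ?thesis by (simp add: r_def)
  qed (simp add: r_def diag_def)
  then obtain q where q: "\<forall>i\<ge>n. coeff q i = 0" "T q - smult (diag n) q = r"
    using shifted_surj_below[OF new] by metis
  define y where "y = monom 1 n + q"
  have "coeff y n = 1" using q(1) by (simp add: y_def)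
  moreover have "coeff y i = 0" if "i > n" for i using q(1) that by (simp add: y_def)
  ultimately have "degree y \<le> n" "n \<le> degree y" "y \<noteq> 0"
    by (auto intro: degree_le le_degree)
  moreover have "T y = smult (diag n) y"
    using q(2) by (simp only: y_def r_def T_add smult_add_right algebra_simps)
  ultimately show ?thesis by (auto simp: eigenfunction_def)
qed

theorem real_eigenvalues_polys_upto:
  "{c. \<exists>y\<in>polys_upto n. eigenfunction T c y} = diag ` {0..n}"
proof (intro equalityI subsetI)
  fix c assume "c \<in> {c. \<exists>y\<in>polys_upto n. eigenfunction T c y}"
  then obtain y where y: "degree y \<le> n" "eigenfunction T c y" by (auto simp: polys_upto_def)
  show "c \<in> diag ` {0..n}"
    using eigenvalue_eq_diag_degree[OF y(2)] y(1) by (intro image_eqI[of _ _ "degree y"]) auto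
next
  fix c assume "c \<in> diag ` {0..n}"
  then obtain j where j: "j \<le> n" "diag j = c" by auto
  \<comment> \<open>With a repeated value of \<open>diag\<close> there may be no eigenfunction of degree \<open>j\<close> itself, but
    there is one at the first index with this value.\<close>
  define m where "m = (LEAST i. diag i = c)"
  have m: "diag m = c" "m \<le> j" unfolding m_def using j(2) by (rule LeastI, rule Least_le)
  have "diag i \<noteq> diag m" if "i < m" for i
    using that not_less_Least[of i "\<lambda>i. diag i = c"] m(1) by (simp add: m_def)
  then obtain y where y: "degree y = m" "eigenfunction T c y"
    using eigenfunction_exists[of m] m(1) by auto
  thus "c \<in> {c. \<exists>y\<in>polys_upto n. eigenfunction T c y}"
    using y m(2) j(1) by (intro CollectI bexI[of _ y]) (simp_all add: polys_upto_def)
qed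

lemma eigenfunction_unique:
  assumes inj: "inj diag" and "degree y = degree z"
    and y: "eigenfunction T c y" and z: "eigenfunction T d z"
  shows "\<exists>r. r \<noteq> 0 \<and> z = smult r y"
proof -
  define n where "n = degree y"
  have deg: "degree y = n" "degree z = n" using assms(2) by (simp_all add: n_def)
  have nz: "y \<noteq> 0" "z \<noteq> 0" using y z by (simp_all add: eigenfunction_def)
  have Ty: "T y = smult (diag n) y" and Tz: "T z = smult (diag n) z"
    using y z eigenvalue_eq_diag_degree[OF y] eigenvalue_eq_diag_degree[OF z] deg
    by (simp_all add: eigenfunction_def)
  \<comment> \<open>chosen so that the leading terms cancel in \<open>z - smult r y\<close>\<close>
  define r where "r = lead_coeff z / lead_coeff y"
  define w where "w = z - smult r y"
  have "r \<noteq> 0" using nz by (simp add: r_def)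
  have "w = 0"
  proof (rule ccontr)
    assume "w \<noteq> 0"
    moreover have "T w = smult (diag n) w"
      by (simp add: w_def T_diff T_scale Ty Tz smult_diff_right mult.commute)
    ultimately have "diag (degree w) = diag n"
      using eigenvalue_eq_diag_degree[of "diag n" w] by (simp add: eigenfunction_def)
    hence "degree w = n" using inj by (simp add: inj_eq)
    moreover have "coeff w n = 0"
    proof -
      have "coeff y n \<noteq> 0" using nz(1) deg(1) leading_coeff_0_iff by metis
      thus ?thesis by (simp add: w_def r_def deg)
    qed
    ultimately show False using \<open>w \<noteq> 0\<close> leading_coeff_0_iff by metis
  qed
  thus ?thesis using \<open>r \<noteq> 0\<close> by (auto simp: w_def)
qed

end

section \<open>Differential operators with polynomial coefficients\<close>

lemma linear_diff_op: "Vector_Spaces.linear smult smult (diff_op N a)"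
  unfolding Vector_Spaces.linear_iff diff_op_def
  by (simp add: poly_vs.vector_space_axioms higher_pderiv_add higher_pderiv_smult
      distrib_left sum.distrib poly_vs.scale_sum_right)

lemma degree_diff_op_le:
  assumes "\<And>k. k \<le> N \<Longrightarrow> degree (a k) \<le> k"
  shows "degree (diff_op N a y) \<le> degree y"
  unfolding diff_op_def
proof (rule degree_sum_le)
  fix k assume "k \<in> {..N}"
  hence ak: "degree (a k) \<le> k" using assms by simp
  show "degree (a k * (pderiv ^^ k) y) \<le> degree y"
  proof (cases "k \<le> degree y")
    case True
    have "degree (a k * (pderiv ^^ k) y) \<le> degree (a k) + (degree y - k)"
      using degree_mult_le[of "a k" "(pderiv ^^ k) y"] by (simp add: degree_higher_pderiv)
    thus ?thesis using ak True by simp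
  next
    case False
    hence "(pderiv ^^ k) y = 0"
      by (simp add: poly_eq_iff coeff_higher_pderiv coeff_eq_0)
    thus ?thesis by simp
  qed
qed simp

theorem proposition1:
  fixes N :: nat and a :: "nat \<Rightarrow> real poly"
    and L :: "real poly \<Rightarrow> real poly" and lam :: "nat \<Rightarrow> real"
  assumes deg: "\<And>k. k \<le> N \<Longrightarrow> degree (a k) \<le> k"
  defines "L \<equiv> diff_op N a"
    and "lam \<equiv> \<lambda>j. coeff (L (monom 1 j)) j"
  shows "(\<forall>n. L ` polys_upto n \<subseteq> polys_upto n
            \<and> (\<forall>z. z \<in># eigenvalues_on (polys_upto n) L \<longrightarrow> z \<in> \<real>)
            \<and> eigenvalues_on (polys_upto n) L
                = image_mset (\<lambda>j. complex_of_real (lam j)) (mset_set {0..n})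
            \<and> {c. \<exists>y\<in>polys_upto n. eigenfunction L c y} = lam ` {0..n})
       \<and> (inj lam \<longrightarrow>
            (\<forall>n. \<exists>y. degree y = n \<and> (\<exists>c. eigenfunction L c y)
              \<and> (\<forall>z. degree z = n \<and> (\<exists>c. eigenfunction L c z)
                    \<longrightarrow> (\<exists>r. r \<noteq> 0 \<and> z = smult r y))))"
proof -
  interpret degree_nonincreasing L
    unfolding L_def by (intro degree_nonincreasing.intro linear_diff_op degree_diff_op_le deg)
  have lam: "lam = diag" by (simp add: fun_eq_iff lam_def diag_def)
  have "\<exists>y. degree y = n \<and> (\<exists>c. eigenfunction L c y)
          \<and> (\<forall>z. degree z = n \<and> (\<exists>c. eigenfunction L c z) \<longrightarrow> (\<exists>r. r \<noteq> 0 \<and> z = smult r y))"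
    if inj: "inj lam" for n
  proof -
    have "\<And>i. i < n \<Longrightarrow> diag i \<noteq> diag n" using inj by (auto simp: lam inj_eq)
    then obtain y where "degree y = n" "eigenfunction L (diag n) y"
      using eigenfunction_exists by blast
    thus ?thesis using eigenfunction_unique[OF inj[unfolded lam]] by metis
  qed
  thus ?thesis
    using image_polys_upto
    by (auto simp: lam eigenvalues_on_polys_upto real_eigenvalues_polys_upto)
qed

end
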